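(* Let ${\tt w}=\ell_0\ell_1\ell_2\cdots\in\mathcal{W}$ begin with the letter ${\tt a}$. Then both $\Delta p_{\tt a}$ and $\Delta p_{\tt b}$ are factors of ${\tt w}$ (that is, there exist maps $\sigma,\sigma':\{{\tt a},{\tt b}\}\to\mathbb{N}$ with $\Delta p_{\tt a}(n)=\sigma(\ell_{n-1})$ and $\Delta p_{\tt b}(n)=\sigma'(\ell_{n-1})$ for all $n\geqslant1$) if and only if either ${\tt w}={\tt f}$ or ${\tt w}=({\tt a}{\tt b})^\omega$. In particular, ${\tt f}$ is the only word in $\mathcal{W}$ beginning with ${\tt a}$ which is isomorphic to both $\Delta p_{\tt a}$ and $\Delta p_{\tt b}$ (i.e. for which such maps $\sigma,\sigma'$ can be chosen injective).
   Context: Words are infinite one-sided words over $\{{\tt a},{\tt b}\}$ indexed from position $0$; $\mathcal{W}$ is the set of such words in which both letters occur infinitely often. For ${\tt w}\in\mathcal{W}$ and $n\geqslant1$, $p_{\tt a}(n)$ (resp. $p_{\tt b}(n)$) is the position of the $n$-th occurrence of ${\tt a}$ (resp. ${\tt b}$), and $\Delta s(n)=s(n+1)-s(n)$ for a sequence $s$. $({\tt a}{\tt b})^\omega$ is the periodic word ${\tt a}{\tt b}{\tt a}{\tt b}\cdots$. The Fibonacci word ${\tt f}=\lim_{n\to\infty}\varrho_F^n({\tt a})={\tt a}{\tt b}{\tt a}{\tt a}{\tt b}{\tt a}{\tt b}{\tt a}\cdots$ is the fixed point of the substitution $\varrho_F:{\tt a}\mapsto{\tt a}{\tt b},\ {\tt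 b}\mapsto{\tt a}$. A sequence taking finitely many values is viewed as a word; it is a factor of ${\tt w}$ if it is the image of ${\tt w}$ under a letter-to-letter map, and isomorphic to ${\tt w}$ if that map is a bijection onto its set of values. *)

theory Defs
  imports Main "HOL-Library.Infinite_Set" "HOL-Library.Sublist"
begin

datatype letter = La | Lb

type_synonym word = "nat \<Rightarrow> letter"

definition \<W> :: "word set" where
  "\<W> = {w. \<forall>c. \<exists>\<^sub>\<infinity>i. w i = c}"

(* Position of the n-th occurrence of c in w, for n >= 1; enumerate counts from 0. *)
definition pos :: "letter \<Rightarrow> word \<Rightarrow> nat \<Rightarrow> nat" where
  "pos c w n = enumerate {i. w i = c} (n - 1)"

(* Only applied to the strictly increasing sequences pos c w (see pos_less), so that the
   subtraction on nat never truncates. *)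
definition Delta :: "(nat \<Rightarrow> nat) \<Rightarrow> nat \<Rightarrow> nat" where
  "Delta s n = s (n + 1) - s n"

(* The sequence s is indexed from 1, the word w from 0. *)
definition is_factor_of :: "(nat \<Rightarrow> 'b) \<Rightarrow> word \<Rightarrow> bool" where
  "is_factor_of s w \<longleftrightarrow> (\<exists>\<sigma>. \<forall>n\<ge>1. s n = \<sigma> (w (n - 1)))"

definition is_isomorphic_to :: "(nat \<Rightarrow> 'b) \<Rightarrow> word \<Rightarrow> bool" where
  "is_isomorphic_to s w \<longleftrightarrow> (\<exists>\<sigma>. inj \<sigma> \<and> (\<forall>n\<ge>1. s n = \<sigma> (w (n - 1))))"

definition ab_omega :: word where
  "ab_omega i = (if even i then La else Lb)"

fun fib_letter :: "letter \<Rightarrow> letter list" where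
  "fib_letter La = [La, Lb]"
| "fib_letter Lb = [La]"

definition fib_subst :: "letter list \<Rightarrow> letter list" where
  "fib_subst u = concat (map fib_letter u)"

definition converges_to :: "(nat \<Rightarrow> letter list) \<Rightarrow> word \<Rightarrow> bool" where
  "converges_to u w \<longleftrightarrow> (\<forall>i. \<exists>N. \<forall>n\<ge>N. i < length (u n) \<and> u n ! i = w i)"

(* The limit exists and is unique, see fib_word_converges. *)
definition fib_word :: word where
  "fib_word = (THE w. converges_to (\<lambda>n. (fib_subst ^^ n) [La]) w)"

lemma pos_less:
  assumes "w \<in> \<W>" and "n \<ge> 1"
  shows "pos c w n < pos c w (n + 1)"
proof -
  have "infinite {i. w i = c}"
    using assms(1) by (auto simp: \<W>_def frequently_cofinite)
  then show ?thesis
    using assms(2) by (simp add: pos_def enumerate_mono)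
qed

lemma converges_to_unique:
  assumes "converges_to u w" and "converges_to u w'"
  shows "w = w'"
proof
  fix i
  obtain N N' where "\<forall>n\<ge>N. u n ! i = w i" and "\<forall>n\<ge>N'. u n ! i = w' i"
    using assms unfolding converges_to_def by meson
  then show "w i = w' i"
    by (metis max.cobounded1 max.cobounded2)
qed

lemma fib_subst_append: "fib_subst (u @ v) = fib_subst u @ fib_subst v"
  by (simp add: fib_subst_def)

lemma fib_subst_prefix: "prefix u v \<Longrightarrow> prefix (fib_subst u) (fib_subst v)"
  by (auto simp: prefix_def fib_subst_append)

lemma fib_iter_prefix_Suc: "prefix ((fib_subst ^^ n) [La]) ((fib_subst ^^ Suc n) [La])"
  by (induction n) (auto simp: fib_subst_def intro: fib_subst_prefix[unfolded fib_subst_def])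

lemma fib_iter_prefix: "m \<le> n \<Longrightarrow> prefix ((fib_subst ^^ m) [La]) ((fib_subst ^^ n) [La])"
  by (induction n rule: dec_induct) (use fib_iter_prefix_Suc prefix_order.trans in blast)+

lemma length_fib_subst: "length (fib_subst u) = length u + count_list u La"
proof (induction u)
  case (Cons x u)
  then show ?case by (cases x) (auto simp: fib_subst_def)
qed (simp add: fib_subst_def)

lemma length_fib_iter: "n < length ((fib_subst ^^ n) [La])"
proof (induction n)
  case (Suc n)
  have "prefix [La] ((fib_subst ^^ n) [La])"
    using fib_iter_prefix[of 0 n] by simp
  then have "count_list ((fib_subst ^^ n) [La]) La \<ge> 1"
    by (auto simp: prefix_def)
  with Suc show ?case by (simp add: length_fib_subst)
qed simp

lemma fib_word_converges: "converges_to (\<lambda>n. (fib_subst ^^ n) [La]) fib_word"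
proof -
  let ?u = "\<lambda>n. (fib_subst ^^ n) [La]"
  have "converges_to ?u (\<lambda>i. ?u i ! i)"
    unfolding converges_to_def
  proof (intro allI exI impI)
    fix i n :: nat
    assume "i \<le> n"
    then have "prefix (?u i) (?u n)" by (rule fib_iter_prefix)
    then show "i < length (?u n) \<and> ?u n ! i = ?u i ! i"
      using length_fib_iter[of i] by (auto simp: prefix_def nth_append)
  qed
  then show ?thesis
    unfolding fib_word_def by (metis converges_to_unique theI)
qed

end

theory Submission
  imports Defs
begin

text \<open>
  Let \<open>w\<close> begin with \<open>a\<close>. If the gaps between consecutive occurrences of \<open>a\<close> are \<open>\<sigma> (w n)\<close>, then
  whether \<open>w m\<close> is an \<open>a\<close> depends only on \<open>\<sigma>\<close> and on the letters before \<open>m\<close>, so \<open>w\<close> is determined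
  by \<open>\<sigma>\<close>. Comparing the positions of both letters in the first few entries of \<open>w\<close> excludes all
  \<open>\<sigma>\<close> except \<open>\<sigma> a = 2\<close> with \<open>\<sigma> b = 1\<close> or \<open>\<sigma> b = 2\<close>, which belong to the Fibonacci word and to
  \<open>(ab)\<^sup>\<omega>\<close>.

  For the Fibonacci word, let \<open>P n\<close> be the length of the image under the substitution of the prefix
  of length \<open>n\<close>. Since this word is a fixed point, its \<open>n\<close>-th \<open>a\<close> is at \<open>P n\<close>, and its \<open>n\<close>-th \<open>b\<close>,
  which ends the image of the \<open>n\<close>-th \<open>a\<close>, is at \<open>P (P n) + 1\<close> (counting from \<open>0\<close>).
\<close>

section \<open>Positions of a letter and the gaps between them\<close>

text \<open>Counting from 0 aligns the gap after occurrence \<open>n\<close> with the letter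
  \<open>w n\<close>, without the shift by one in \<open>pos\<close>.\<close>

definition occ :: "letter \<Rightarrow> word \<Rightarrow> nat \<Rightarrow> nat" where
  "occ c w = enumerate {i. w i = c}"

lemma infinite_letter: "w \<in> \<W> \<Longrightarrow> infinite {i. w i = c}"
  by (auto simp: \<W>_def frequently_cofinite)

lemma occ_letter: "w \<in> \<W> \<Longrightarrow> w (occ c w n) = c"
  using enumerate_in_set[OF infinite_letter[of w c]] by (simp add: occ_def)

lemma occ_less_Suc: "w \<in> \<W> \<Longrightarrow> occ c w n < occ c w (Suc n)"
  by (simp add: occ_def enumerate_mono infinite_letter)

lemma letter_iff_occ: "w \<in> \<W> \<Longrightarrow> w j = c \<longleftrightarrow> (\<exists>n. j = occ c w n)"
  using range_enumerate[OF infinite_letter[of w c]] by (auto simp: occ_def)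

lemma not_letter_below_occ_0: "w \<in> \<W> \<Longrightarrow> j < occ c w 0 \<Longrightarrow> w j \<noteq> c"
  by (metis (mono_tags) enumerate_0 mem_Collect_eq not_less_Least occ_def)

lemma not_letter_between_occ:
  assumes "w \<in> \<W>" "occ c w n < j" "j < occ c w (Suc n)"
  shows "w j \<noteq> c"
proof
  assume "w j = c"
  then obtain m where m: "j = occ c w m"
    using assms(1) letter_iff_occ by blast
  have "strict_mono (occ c w)"
    by (simp add: assms(1) occ_less_Suc strict_mono_Suc_iff)
  then have "n < m" "m < Suc n"
    using assms(2,3) m strict_mono_less by blast+
  then show False by simp
qed

text \<open>Positions increase, so the subtraction in \<open>Delta\<close> is exact and each gap
  condition becomes a recurrence for \<open>occ\<close>. The same map \<open>\<sigma>\<close> serves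
  on both sides, so injectivity carries over.\<close>

lemma Delta_pos_factor_isomorphic_iff:
  assumes "w \<in> \<W>"
  shows "is_factor_of (Delta (pos c w)) w \<longleftrightarrow>
    (\<exists>\<sigma>. \<forall>n. occ c w (Suc n) = occ c w n + \<sigma> (w n))"
    (is "_ \<longleftrightarrow> (\<exists>\<sigma>. ?R \<sigma>)")
  and "is_isomorphic_to (Delta (pos c w)) w \<longleftrightarrow>
    (\<exists>\<sigma>. inj \<sigma> \<and> (\<forall>n. occ c w (Suc n) = occ c w n + \<sigma> (w n)))"
proof -
  have *: "(\<forall>n\<ge>1. Delta (pos c w) n = \<sigma> (w (n - 1))) \<longleftrightarrow> ?R \<sigma>" for \<sigma>
  proof
    assume L: "\<forall>n\<ge>1. Delta (pos c w) n = \<sigma> (w (n - 1))"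
    show "?R \<sigma>"
    proof
      fix n
      show "occ c w (Suc n) = occ c w n + \<sigma> (w n)"
        using L[rule_format, of "Suc n"] occ_less_Suc[OF assms, of c n]
        by (simp add: Delta_def pos_def occ_def)
    qed
  next
    assume R: "?R \<sigma>"
    show "\<forall>n\<ge>1. Delta (pos c w) n = \<sigma> (w (n - 1))"
    proof (intro allI impI)
      fix n :: nat assume "n \<ge> 1"
      then obtain m where "n = Suc m" by (cases n) auto
      then show "Delta (pos c w) n = \<sigma> (w (n - 1))"
        using R[rule_format, of m] by (simp add: Delta_def pos_def occ_def)
    qed
  qed
  show "is_factor_of (Delta (pos c w)) w \<longleftrightarrow> (\<exists>\<sigma>. ?R \<sigma>)"
    by (simp only: is_factor_of_def *)
  show "is_isomorphic_to (Delta (pos c w)) w \<longleftrightarrow> (\<exists>\<sigma>. inj \<sigma> \<and> ?R \<sigma>)"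
    by (simp only: is_isomorphic_to_def *)
qed

text \<open>Only one strictly increasing sequence has a given range; this reads \<open>occ\<close>
  off an explicit formula.\<close>

lemma occ_eqI:
  assumes "strict_mono P" "\<And>j. w j = c \<longleftrightarrow> (\<exists>n. j = P n)"
  shows "occ c w = P"
proof -
  have S: "{i. w i = c} = range P"
    using assms(2) by auto
  have inf: "infinite (range P)"
    by (simp add: assms(1) range_inj_infinite strict_mono_imp_inj_on)
  have "enumerate (range P) n = P n" for n
  proof (induction n)
    case 0
    then show ?case
      using assms(1) by (auto simp: enumerate_0 strict_mono_less_eq intro!: Least_equality)
  next
    case (Suc n)
    then show ?case
      using assms(1) inf
      by (auto simp: enumerate_Suc'' strict_mono_less strict_mono_less_eq Suc_le_eq
          intro!: Least_equality)
  qed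
  then show ?thesis
    by (auto simp: occ_def S)
qed

lemma in_\<W>I:
  fixes P Q :: "nat \<Rightarrow> nat"
  assumes "strict_mono P" "\<And>j. w j = La \<longleftrightarrow> (\<exists>n. j = P n)"
    and "strict_mono Q" "\<And>j. w j = Lb \<longleftrightarrow> (\<exists>n. j = Q n)"
  shows "w \<in> \<W>"
proof -
  have "infinite {i. w i = c}" if "strict_mono R" "\<And>j. w j = c \<longleftrightarrow> (\<exists>n. j = R n)"
    for R :: "nat \<Rightarrow> nat" and c
  proof -
    have "{i. w i = c} = range R" using that(2) by auto
    then show ?thesis
      by (simp add: that(1) range_inj_infinite strict_mono_imp_inj_on)
  qed
  from this[OF assms(1,2)] this[OF assms(3,4)] have "infinite {i. w i = c}" for c
    by (cases c) auto
  then show ?thesis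
    by (simp add: \<W>_def frequently_cofinite)
qed

section \<open>Reconstruction of a word from its gaps between \<open>La\<close>s\<close>

lemma occ_La_0: "w \<in> \<W> \<Longrightarrow> w 0 = La \<Longrightarrow> occ La w 0 = 0"
  by (metis gr0I not_letter_below_occ_0)

lemma occ_La_eq_sum:
  assumes "w \<in> \<W>" "w 0 = La" "\<And>n. occ La w (Suc n) = occ La w n + \<sigma> (w n)"
  shows "occ La w n = (\<Sum>i<n. \<sigma> (w i))"
  by (induction n) (auto simp: assms occ_La_0)

lemma word_eq_if_La_gaps_eq:
  assumes w: "w \<in> \<W>" "w 0 = La" "\<And>n. occ La w (Suc n) = occ La w n + \<sigma> (w n)"
    and w': "w' \<in> \<W>" "w' 0 = La" "\<And>n. occ La w' (Suc n) = occ La w' n + \<sigma> (w' n)"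
  shows "w = w'"
proof
  fix m show "w m = w' m"
  proof (induction m rule: less_induct)
    case (less m)
    \<comment> \<open>Since \<open>n \<le> occ La v n\<close>, an \<open>La\<close> at
      \<open>m\<close> has index at most \<open>m\<close>. Its position is then a sum over letters
      strictly before \<open>m\<close>, which the induction hypothesis covers.\<close>
    have bounded: "v m = La \<longleftrightarrow> (\<exists>n\<le>m. m = occ La v n)" if "v \<in> \<W>" for v
      by (metis (no_types, lifting) le_enumerate infinite_letter letter_iff_occ occ_def that)
    have "occ La w n = occ La w' n" if "n \<le> m" for n
      unfolding occ_La_eq_sum[of w \<sigma>, OF w] occ_La_eq_sum[of w' \<sigma>, OF w']
      using that less by (intro sum.cong) auto
    then have "w m = La \<longleftrightarrow> w' m = La"
      using bounded w(1) w'(1) by metis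
    then show ?case
      by (cases "w m"; cases "w' m") auto
  qed
qed

section \<open>Positions in the periodic word\<close>

lemma ab_omega_occ: "ab_omega \<in> \<W>" "occ La ab_omega n = 2 * n" "occ Lb ab_omega n = 2 * n + 1"
proof -
  have P: "strict_mono (\<lambda>n::nat. 2 * n)" "ab_omega j = La \<longleftrightarrow> (\<exists>n. j = 2 * n)" for j
    by (auto simp: strict_mono_def ab_omega_def elim: evenE)
  have Q: "strict_mono (\<lambda>n::nat. 2 * n + 1)" "ab_omega j = Lb \<longleftrightarrow> (\<exists>n. j = 2 * n + 1)" for j
    by (auto simp: strict_mono_def ab_omega_def elim: oddE)
  show "ab_omega \<in> \<W>" using in_\<W>I P Q by blast
  show "occ La ab_omega n = 2 * n" using fun_cong[OF occ_eqI[OF P]] .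
  show "occ Lb ab_omega n = 2 * n + 1" using fun_cong[OF occ_eqI[OF Q]] .
qed

section \<open>The Fibonacci word: blocks, positions and gaps\<close>

text \<open>This is \<open>P\<close> above: the place in \<open>fib_word\<close> where block
  \<open>n\<close>, the image of the letter \<open>fib_word n\<close>, starts.\<close>

definition fib_len :: "nat \<Rightarrow> nat" where
  "fib_len n = length (fib_subst (map fib_word [0..<n]))"

lemma fib_len_0: "fib_len 0 = 0"
  by (simp add: fib_len_def fib_subst_def)

lemma fib_len_Suc: "fib_len (Suc n) = fib_len n + length (fib_letter (fib_word n))"
  by (simp add: fib_len_def fib_subst_def)

lemma fib_subst_Cons: "fib_subst (c # u) = fib_letter c @ fib_subst u"
  by (simp add: fib_subst_def)

lemma fib_iter_nth:
  assumes "i < length ((fib_subst ^^ n) [La])"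
  shows "(fib_subst ^^ n) [La] ! i = fib_word i"
proof -
  obtain N where N: "\<And>m. m \<ge> N \<Longrightarrow> (fib_subst ^^ m) [La] ! i = fib_word i"
    using fib_word_converges unfolding converges_to_def by meson
  have "prefix ((fib_subst ^^ n) [La]) ((fib_subst ^^ (max n N)) [La])"
    by (rule fib_iter_prefix) simp
  then show ?thesis
    using N[of "max n N"] assms by (auto simp: prefix_def nth_append)
qed

lemma fib_word_fixed_point:
  assumes "r < length (fib_letter (fib_word n))"
  shows "fib_word (fib_len n + r) = fib_letter (fib_word n) ! r"
proof -
  let ?u = "(fib_subst ^^ n) [La]"
  have n: "n < length ?u" by (rule length_fib_iter)
  have "take n ?u = map fib_word [0..<n]"
    using n by (intro nth_equalityI) (auto simp: fib_iter_nth)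
  moreover have "?u ! n = fib_word n"
    using n by (rule fib_iter_nth)
  \<comment> \<open>Splitting the iterate around its letter \<open>n\<close> makes the image of that
    letter appear at \<open>fib_len n\<close> in the next iterate, which agrees with
    \<open>fib_word\<close>.\<close>
  ultimately have "?u = map fib_word [0..<n] @ [fib_word n] @ drop (Suc n) ?u"
    using n by (metis append_Cons append_Nil id_take_nth_drop)
  from arg_cong[OF this, of fib_subst] have "(fib_subst ^^ Suc n) [La] = fib_subst (map fib_word [0..<n]) @
      fib_letter (fib_word n) @ fib_subst (drop (Suc n) ?u)"
    by (simp add: fib_subst_append fib_subst_Cons)
  then show ?thesis
    using fib_iter_nth[of "fib_len n + r" "Suc n"] assms
    by (simp add: fib_len_def nth_append del: funpow.simps)
qed

lemma strict_mono_fib_len: "strict_mono fib_len"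
proof -
  have "0 < length (fib_letter c)" for c by (cases c) auto
  then show ?thesis by (simp add: strict_mono_Suc_iff fib_len_Suc)
qed

lemma fib_word_fib_len: "fib_word (fib_len n) = La"
  using fib_word_fixed_point[of 0 n] by (cases "fib_word n") auto

lemma fib_word_Suc_fib_len: "fib_word n = La \<Longrightarrow> fib_word (Suc (fib_len n)) = Lb"
  using fib_word_fixed_point[of 1 n] by simp

text \<open>Blocks tile the positions: they have one or two letters, and two only for
  \<open>La\<close>. So the successor of a position is the second letter of the same block or the
  start of the next block.\<close>

lemma fib_block_cases:
  obtains n where "j = fib_len n" | n where "j = Suc (fib_len n)" "fib_word n = La"
proof -
  have "\<exists>n. j = fib_len n \<or> (j = Suc (fib_len n) \<and> fib_word n = La)"
  proof (induction j)
    case 0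
    show ?case by (metis fib_len_0)
  next
    case (Suc j)
    then obtain n where "j = fib_len n \<or> (j = Suc (fib_len n) \<and> fib_word n = La)" by blast
    then show ?case
    proof
      assume j: "j = fib_len n"
      show ?thesis
      proof (cases "fib_word n")
        case Lb
        then have "Suc j = fib_len (Suc n)" by (simp add: j fib_len_Suc)
        then show ?thesis by blast
      qed (use j in auto)
    next
      assume "j = Suc (fib_len n) \<and> fib_word n = La"
      then have "Suc j = fib_len (Suc n)" by (simp add: fib_len_Suc)
      then show ?thesis by blast
    qed
  qed
  then show thesis using that by blast
qed

lemma fib_word_La_iff: "fib_word j = La \<longleftrightarrow> (\<exists>n. j = fib_len n)"
proof (cases j rule: fib_block_cases)
  case (1 n)
  then show ?thesis using fib_word_fib_len by auto
next
  case (2 n)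
  then have "fib_word j = Lb" by (simp add: fib_word_Suc_fib_len)
  then show ?thesis using fib_word_fib_len by auto
qed

lemma fib_word_Lb_iff: "fib_word j = Lb \<longleftrightarrow> (\<exists>n. j = Suc (fib_len (fib_len n)))"
proof (cases j rule: fib_block_cases)
  case (1 n)
  then have "fib_word j = La" by (simp add: fib_word_fib_len)
  then show ?thesis using fib_word_Suc_fib_len[OF fib_word_fib_len] by auto
next
  case (2 n)
  then obtain m where "n = fib_len m" using fib_word_La_iff by blast
  with 2 show ?thesis using fib_word_Suc_fib_len by auto
qed

lemma fib_word_occ:
  "fib_word \<in> \<W>" "occ La fib_word = fib_len" "occ Lb fib_word = (\<lambda>n. Suc (fib_len (fib_len n)))"
proof -
  have Q: "strict_mono (\<lambda>n. Suc (fib_len (fib_len n)))"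
    using strict_mono_fib_len by (simp add: strict_mono_def)
  show "fib_word \<in> \<W>"
    using in_\<W>I strict_mono_fib_len fib_word_La_iff Q fib_word_Lb_iff by blast
  show "occ La fib_word = fib_len"
    using occ_eqI strict_mono_fib_len fib_word_La_iff by blast
  show "occ Lb fib_word = (\<lambda>n. Suc (fib_len (fib_len n)))"
    using Q fib_word_Lb_iff by (rule occ_eqI)
qed

lemma fib_word_0: "fib_word 0 = La"
  using fib_word_fib_len[of 0] by (simp add: fib_len_0)

lemma fib_word_La_gaps:
  "occ La fib_word (Suc n) = occ La fib_word n + case_letter 2 1 (fib_word n)"
  by (cases "fib_word n") (auto simp: fib_word_occ fib_len_Suc)

text \<open>The gaps are the lengths of the images under the squared substitution, which sends a to
  aba and b to ab.\<close>

lemma fib_word_Lb_gaps: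
  "occ Lb fib_word (Suc n) = occ Lb fib_word n + case_letter 3 2 (fib_word n)"
  by (cases "fib_word n")
    (auto simp: fib_word_occ fib_len_Suc fib_word_fib_len fib_word_Suc_fib_len)

section \<open>Exclusion of all other gap values\<close>

text \<open>Otherwise \<open>c\<close> fills every position from \<open>k\<close> on, although
  \<open>d\<close> also occurs there.\<close>

lemma occ_not_shift:
  assumes "w \<in> \<W>" "c \<noteq> d" "\<And>n. occ c w n = n + k"
  shows False
proof -
  have "w (occ d w k) = d"
    using assms(1) by (rule occ_letter)
  moreover have "k \<le> occ d w k"
    using assms(1) by (simp add: occ_def le_enumerate infinite_letter)
  moreover from this have "w (occ d w k) = c"
    using assms(1,3) by (metis le_add_diff_inverse2 occ_letter)
  ultimately show False using assms(2) by simp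
qed

lemma La_gaps_if_both_factors:
  assumes w: "w \<in> \<W>" "w 0 = La"
    and A: "\<And>n. occ La w (Suc n) = occ La w n + \<sigma> (w n)"
    and B: "\<And>n. occ Lb w (Suc n) = occ Lb w n + \<tau> (w n)"
  shows "\<sigma> La = 2 \<and> (\<sigma> Lb = 1 \<or> \<sigma> Lb = 2)"
proof -
  have not_La: "w j = Lb" if "occ La w n < j" "j < occ La w (Suc n)" for n j
    using not_letter_between_occ[OF w(1) that] by (cases "w j") auto
  have not_Lb: "w j = La" if "occ Lb w n < j" "j < occ Lb w (Suc n)" for n j
    using not_letter_between_occ[OF w(1) that] by (cases "w j") auto
  have not_La1: "w j = Lb" if "occ La w 1 < j" "j < occ La w 2" for j
    using not_La[of 1 j] that by (simp only: Suc_1)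
  have not_Lb1: "w j = La" if "occ Lb w 1 < j" "j < occ Lb w 2" for j
    using not_Lb[of 1 j] that by (simp only: Suc_1)
  have a0: "occ La w 0 = 0" using w by (rule occ_La_0)
  have a1: "occ La w 1 = \<sigma> La" using A[of 0] a0 w(2) by simp
  have a_pos: "\<sigma> La > 0" using occ_less_Suc[OF w(1), of La 0] a0 a1 by simp
  \<comment> \<open>With gap 1 after each \<open>La\<close>, an \<open>La\<close> at
    \<open>n\<close> forces one at \<open>n + 1\<close>, so the word never contains
    \<open>Lb\<close>.\<close>
  have "\<sigma> La \<noteq> 1"
  proof
    assume s: "\<sigma> La = 1"
    have "occ La w n = n + 0" for n
    proof (induction n)
      case (Suc n)
      then show ?case using A[of n] s occ_letter[OF w(1), of La n] by simp
    qed (use a0 in simp)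
    then show False using occ_not_shift[OF w(1), of La Lb] by blast
  qed
  with a_pos have s2: "\<sigma> La \<ge> 2" by simp
  then have w1: "w 1 = Lb" using not_La[of 0 1] a0 a1 by simp
  have b0: "occ Lb w 0 = 1"
  proof -
    have "\<not> 1 < occ Lb w 0"
      using not_letter_below_occ_0[OF w(1), of 1 Lb] w1 by auto
    moreover have "occ Lb w 0 \<noteq> 0"
      by (metis letter.distinct(1) occ_letter w)
    ultimately show ?thesis by linarith
  qed
  have b1: "occ Lb w 1 = 1 + \<tau> La" using B[of 0] b0 w(2) by simp
  have b2: "occ Lb w 2 = 1 + \<tau> La + \<tau> Lb"
    using B[of 1] b1 w1 by (simp only: Suc_1)
  have u_pos: "\<tau> La > 0" using occ_less_Suc[OF w(1), of Lb 0] b0 b1 by simp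
  have v_pos: "\<tau> Lb > 0" using occ_less_Suc[OF w(1), of Lb 1] b1 b2 by (simp only: Suc_1)
  have a2: "occ La w 2 = \<sigma> La + \<sigma> Lb"
    using A[of 1] a1 w1 by (simp only: Suc_1)
  have t_pos: "\<sigma> Lb > 0" using occ_less_Suc[OF w(1), of La 1] a1 a2 by (simp only: Suc_1)
  have s: "\<sigma> La = 2"
  proof (rule ccontr)
    assume "\<sigma> La \<noteq> 2"
    with s2 have s3: "\<sigma> La \<ge> 3" by simp
    then have w2: "w 2 = Lb" using not_La[of 0 2] a0 a1 by simp
    \<comment> \<open>The first \<open>Lb\<close> is at 1 and position 2 holds the next one.\<close>
    have u: "\<tau> La = 1"
      using not_Lb[of 0 2] b0 b1 w2 u_pos by force
    have "\<tau> Lb \<noteq> 1"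
    proof
      assume v: "\<tau> Lb = 1"
      have "\<tau> c = 1" for c using u v by (cases c) auto
      then have "occ Lb w n = n + 1" for n
        by (induction n) (auto simp: b0 B)
      then show False using occ_not_shift[OF w(1), of Lb La] by blast
    qed
    with v_pos have v2: "\<tau> Lb \<ge> 2" by simp
    have w3: "w 3 = La" using not_Lb1[of 3] b1 b2 u v2 by simp
    \<comment> \<open>The \<open>La\<close> at 3 ends the first gap, so that gap cannot exceed
      3.\<close>
    have s: "\<sigma> La = 3" using not_La[of 0 3] a0 a1 s3 w3 by force
    have a3: "occ La w 3 = 3 + 2 * \<sigma> Lb" using A[of 2] a2 s w2 by simp
    have a4: "occ La w 4 = 6 + 2 * \<sigma> Lb" using A[of 3] a3 s w3 by simp
    have b3: "occ Lb w 3 = 2 + 2 * \<tau> Lb" using B[of 2] b2 u w2 by simp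
    have b4: "occ Lb w 4 = 3 + 2 * \<tau> Lb" using B[of 3] b3 u w3 by simp
    consider "\<sigma> Lb = 1" | "\<sigma> Lb = 2" | "\<sigma> Lb \<ge> 3" using t_pos by linarith
    then show False
    proof cases
      \<comment> \<open>The word starts abbaaabb. The third \<open>Lb\<close> is at
        \<open>2 + \<tau> Lb\<close>, so \<open>\<tau> Lb \<ge> 4\<close>. The value 4 would put an
        \<open>La\<close> at 7, a larger one an \<open>La\<close> at 6.\<close>
      case 1
      then have "w 4 = La" "w 5 = La" "w 6 = Lb" "w 7 = Lb"
        using occ_letter[OF w(1), of La 2] occ_letter[OF w(1), of La 3]
          not_La[of 3 6] not_La[of 3 7] a2 a3 a4 s by simp_all
      moreover have "w (2 + \<tau> Lb) = Lb" using occ_letter[OF w(1), of Lb 2] b2 u by simp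
      ultimately have "\<tau> Lb \<noteq> 2" "\<tau> Lb \<noteq> 3" by auto
      with v2 have "\<tau> Lb \<ge> 4" by linarith
      then have "w 7 = La \<or> w 6 = La"
        using not_Lb[of 2 7] not_Lb1[of 6] not_Lb[of 2 6] b1 b2 b3 u
        by (cases "\<tau> Lb = 4") auto
      then show False using \<open>w 6 = Lb\<close> \<open>w 7 = Lb\<close> by simp
    next
      \<comment> \<open>The \<open>Lb\<close> at 4 gives \<open>\<tau> Lb = 2\<close>, which places
        the fifth \<open>Lb\<close> at 7, where the fourth \<open>La\<close> stands.\<close>
      case 2
      then have w4: "w 4 = Lb" and w7: "w 7 = La"
        using not_La1[of 4] occ_letter[OF w(1), of La 3] a1 a2 a3 s
        by simp_all
      have "\<tau> Lb = 2" using not_Lb1[of 4] b1 b2 u w4 v2 by force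
      then show False using occ_letter[OF w(1), of Lb 4] b4 w7 by simp
    next
      \<comment> \<open>The \<open>Lb\<close> at 4 gives \<open>\<tau> Lb = 2\<close>, so the next
        one is at 6, contrary to the \<open>Lb\<close> at 5.\<close>
      case 3
      then have w45: "w 4 = Lb" "w 5 = Lb"
        using not_La1[of 4] not_La1[of 5] a1 a2 s by simp_all
      have "\<tau> Lb = 2" using not_Lb1[of 4] b1 b2 u w45 v2 by force
      then show False using not_Lb[of 2 5] b2 b3 u w45 by simp
    qed
  qed
  have w2: "w 2 = La" using occ_letter[OF w(1), of La 1] a1 s by simp
  \<comment> \<open>Otherwise the word starts ababb, so \<open>\<tau> La = 2\<close> and
    \<open>\<tau> Lb = 1\<close>. This puts the next two \<open>Lb\<close>s at 6 and 7; the
    \<open>La\<close> at 5 then gives \<open>\<sigma> Lb = 3\<close> and an \<open>La\<close> at 7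
    as well.\<close>
  have "\<sigma> Lb < 3"
  proof (rule ccontr)
    assume "\<not> \<sigma> Lb < 3"
    then have w34: "w 3 = Lb" "w 4 = Lb"
      using not_La1[of 3] not_La1[of 4] a1 a2 s by simp_all
    have "w (1 + \<tau> La) = Lb" using occ_letter[OF w(1), of Lb 1] b1 by simp
    then have "\<tau> La \<noteq> 1" using w2 by (auto simp: numeral_2_eq_2)
    then have u: "\<tau> La = 2" using not_Lb[of 0 3] b0 b1 w34 u_pos by force
    have v: "\<tau> Lb = 1" using not_Lb1[of 4] b1 b2 u w34 v_pos by force
    have b3: "occ Lb w 3 = 6" using B[of 2] b2 u v w2 by simp
    have b4: "occ Lb w 4 = 7" using B[of 3] b3 v w34 by simp
    have w5: "w 5 = La" using not_Lb[of 2 5] b2 b3 u v by simp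
    have t: "\<sigma> Lb = 3"
      using not_La1[of 5] a1 a2 s w5 \<open>\<not> \<sigma> Lb < 3\<close> by force
    have "occ La w 3 = 7" using A[of 2] a2 s t w2 by simp
    then show False
      using occ_letter[OF w(1), of La 3] occ_letter[OF w(1), of Lb 4] b4 by simp
  qed
  with s t_pos show ?thesis by linarith
qed

section \<open>The characterization and the isomorphic case\<close>

lemma both_factors_iff:
  assumes w: "w \<in> \<W>" "w 0 = La"
  shows "is_factor_of (Delta (pos La w)) w \<and> is_factor_of (Delta (pos Lb w)) w \<longleftrightarrow>
    w = fib_word \<or> w = ab_omega" (is "?L \<longleftrightarrow> ?R")
proof
  assume ?L
  then obtain \<sigma> \<tau> where A: "\<And>n. occ La w (Suc n) = occ La w n + \<sigma> (w n)"
    and B: "\<And>n. occ Lb w (Suc n) = occ Lb w n + \<tau> (w n)"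
    unfolding Delta_pos_factor_isomorphic_iff[OF w(1)] by blast
  have s: "\<sigma> La = 2" and "\<sigma> Lb = 1 \<or> \<sigma> Lb = 2"
    using La_gaps_if_both_factors[of w \<sigma> \<tau>, OF w A B] by auto
  then consider "\<sigma> Lb = 1" | "\<sigma> Lb = 2" by blast
  then show ?R
  proof cases
    case 1
    then have "\<sigma> c = case_letter 2 1 c" for c using s by (cases c) auto
    then have "w = fib_word"
      by (intro word_eq_if_La_gaps_eq[of w \<sigma>, OF w A fib_word_occ(1) fib_word_0])
        (simp add: fib_word_La_gaps)
    then show ?thesis ..
  next
    case 2
    then have "\<sigma> c = 2" for c using s by (cases c) auto
    then have "w = ab_omega"
      by (intro word_eq_if_La_gaps_eq[of w \<sigma>, OF w A ab_omega_occ(1)])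
        (simp_all add: ab_omega_occ ab_omega_def)
    then show ?thesis ..
  qed
next
  assume ?R
  then show ?L
    unfolding Delta_pos_factor_isomorphic_iff[OF w(1)]
  proof
    assume "w = fib_word"
    then show "(\<exists>\<sigma>. \<forall>n. occ La w (Suc n) = occ La w n + \<sigma> (w n)) \<and>
      (\<exists>\<sigma>. \<forall>n. occ Lb w (Suc n) = occ Lb w n + \<sigma> (w n))"
      using fib_word_La_gaps fib_word_Lb_gaps by blast
  next
    assume "w = ab_omega"
    then show "(\<exists>\<sigma>. \<forall>n. occ La w (Suc n) = occ La w n + \<sigma> (w n)) \<and>
      (\<exists>\<sigma>. \<forall>n. occ Lb w (Suc n) = occ Lb w n + \<sigma> (w n))"
      by (auto simp: ab_omega_occ intro!: exI[of _ "\<lambda>_. 2"])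
  qed
qed

lemma fib_word_isomorphic: "is_isomorphic_to (Delta (pos c fib_word)) fib_word"
proof -
  have "inj (case_letter 2 (1::nat))" "inj (case_letter 3 (2::nat))"
    by (auto simp: inj_def split: letter.splits)
  then show ?thesis
    unfolding Delta_pos_factor_isomorphic_iff(2)[OF fib_word_occ(1)]
    using fib_word_La_gaps fib_word_Lb_gaps by (cases c) blast+
qed

text \<open>All gaps are 2, so the map takes the same value at both letters.\<close>

lemma ab_omega_not_isomorphic: "\<not> is_isomorphic_to (Delta (pos La ab_omega)) ab_omega"
proof
  assume "is_isomorphic_to (Delta (pos La ab_omega)) ab_omega"
  then obtain \<sigma> where "inj \<sigma>" and "\<And>n. 2 * Suc n = 2 * n + \<sigma> (ab_omega n)"
    unfolding Delta_pos_factor_isomorphic_iff(2)[OF ab_omega_occ(1)] ab_omega_occ by blast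
  from this(2)[of 0] this(2)[of 1] have "\<sigma> La = \<sigma> Lb"
    by (simp add: ab_omega_def)
  with \<open>inj \<sigma>\<close> show False by (simp add: inj_eq)
qed

theorem theorem4p10:
  "(\<forall>w\<in>\<W>. w 0 = La \<longrightarrow>
      ((is_factor_of (Delta (pos La w)) w \<and> is_factor_of (Delta (pos Lb w)) w)
        \<longleftrightarrow> (w = fib_word \<or> w = ab_omega)))
   \<and> {w \<in> \<W>. w 0 = La \<and> is_isomorphic_to (Delta (pos La w)) w
          \<and> is_isomorphic_to (Delta (pos Lb w)) w} = {fib_word}"
proof -
  have "is_factor_of s w" if "is_isomorphic_to s w" for s :: "nat \<Rightarrow> nat" and w
    using that unfolding is_factor_of_def is_isomorphic_to_def by blast
  then have "w = fib_word" if "w \<in> \<W>" "w 0 = La" "is_isomorphic_to (Delta (pos La w)) w"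
    "is_isomorphic_to (Delta (pos Lb w)) w" for w
    using that both_factors_iff ab_omega_not_isomorphic by blast
  then show ?thesis
    using both_factors_iff fib_word_isomorphic fib_word_occ(1) fib_word_0 by blast
qed

end
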